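(* Let $(M,J,g)$ and $(M,J,\tilde g)$ be quasi-Kähler manifolds with Norden metric, where $\tilde g(X,Y)=g(X,JY)$ is the metric associated with $g$. Then the following two objects are invariant under the transformation $\nabla\to\tilde\nabla$ between the Levi-Civita connections of $g$ and $\tilde g$: $$S(x,y)=\nabla_xy+\tfrac12T(x,y),\qquad P(x,y)z=R(x,y)z+\tfrac12Q(x,y)z.$$ That is, for all vector fields $x,y,z$, $$\tilde\nabla_xy+\tfrac12\tilde T(x,y)=\nabla_xy+\tfrac12T(x,y),\qquad \tilde R(x,y)z+\tfrac12\tilde Q(x,y)z=R(x,y)z+\tfrac12Q(x,y)z.$$
   Context: An almost complex manifold with Norden metric $(M,J,g)$ is a smooth $2n$-dimensional manifold with a $(1,1)$-tensor field $J$ and a pseudo-Riemannian metric $g$ such that $J^2X=-X$ and $g(JX,JY)=-g(X,Y)$ for all vector fields $X,Y$ ($g$ is then necessarily of signature $(n,n)$). The associated metric $\tilde g(X,Y)=g(X,JY)$ is then also a Norden metric. Let $\nabla$, $\tilde\nabla$ be the Levi-Civita connections of $g$, $\tilde g$, and set $F(X,Y,Z)=g((\nabla_XJ)Y,Z)$ and $\tilde F(X,Y,Z)=\tilde g((\tilde\nabla_XJ)Y,Z)$. The manifold $(M,J,g)$ is called quasi-Kähler with Norden metric (class $\mathcal W_3$) if $F(X,Y,Z)+F(Y,Z,X)+F(Z,X,Y)=0$ for all $X,Y,Z$; likewise $(M,J,\tilde g)$ is quasi-Kähler with Norden metric if the cyclic sum of $\tilde F$ vanishes. Put $R(x,y)z=\nabla_x\nabla_yz-\nabla_y\nabla_xz-\nabla_{[x,y]}z$,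 $$T(x,y)=(\nabla_xJ)Jy+(\nabla_yJ)Jx,$$ $$Q(x,y)z=(\nabla_xT)(y,z)-(\nabla_yT)(x,z)+T(x,T(y,z))-T(y,T(x,z)).$$ The objects $\tilde R$, $\tilde T$, $\tilde Q$ are defined by the same formulas with $\nabla$ replaced by $\tilde\nabla$ (and, in $\tilde Q$, $T$ replaced by $\tilde T$). *)

theory Defs
  imports "HOL-Analysis.Analysis" "HOL-Library.Function_Algebras"
begin

text \<open>
  Manifolds are types of class t2_space and second_countable_topology with an explicit
  smooth atlas (not required to be maximal); the dimension is that of the model space.
  Sums, differences and products of functions, tangent vectors and vector fields
  are the pointwise ones of Function_Algebras.
\<close>

section \<open>Smooth manifolds\<close>

text \<open>Only used for open sets S. On these the last predicate is the usual C-infinity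
  regularity: all iterated directional derivatives exist and are continuous.\<close>

primrec C_k_on ::
  "nat \<Rightarrow> 'e::real_normed_vector set \<Rightarrow> ('e \<Rightarrow> 'f::real_normed_vector) \<Rightarrow> bool" where
  "C_k_on 0 S f \<longleftrightarrow> continuous_on S f"
| "C_k_on (Suc k) S f \<longleftrightarrow>
     (\<forall>x\<in>S. f differentiable (at x)) \<and>
     (\<forall>v. C_k_on k S (\<lambda>x. frechet_derivative f (at x) v))"

definition smooth_on ::
  "'e::real_normed_vector set \<Rightarrow> ('e \<Rightarrow> 'f::real_normed_vector) \<Rightarrow> bool" where
  "smooth_on S f \<longleftrightarrow> (\<forall>k. C_k_on k S f)"

type_synonym ('a, 'e) atlas = "('a set \<times> ('a \<Rightarrow> 'e)) set"

definition chart :: "'a::topological_space set \<Rightarrow> ('a \<Rightarrow> 'e::euclidean_space) \<Rightarrow> bool" where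
  "chart U \<phi> \<longleftrightarrow> open U \<and> open (\<phi> ` U) \<and> homeomorphism U (\<phi> ` U) \<phi> (inv_into U \<phi>)"

definition smooth_manifold ::
  "('a::{t2_space, second_countable_topology}, 'e::euclidean_space) atlas \<Rightarrow> bool" where
  "smooth_manifold A \<longleftrightarrow>
     (\<forall>(U, \<phi>)\<in>A. chart U \<phi>) \<and>
     (\<Union>(U, \<phi>)\<in>A. U) = UNIV \<and>
     (\<forall>(U, \<phi>)\<in>A. \<forall>(V, \<psi>)\<in>A. smooth_on (\<phi> ` (U \<inter> V)) (\<psi> \<circ> inv_into U \<phi>))"

definition smooth_functions ::
  "('a::topological_space, 'e::euclidean_space) atlas \<Rightarrow> ('a \<Rightarrow> real) set" where
  "smooth_functions A = {f. \<forall>(U, \<phi>)\<in>A. smooth_on (\<phi> ` U) (f \<circ> inv_into U \<phi>)}"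

section \<open>Tangent vectors and vector fields\<close>

text \<open>A tangent vector at p is a derivation at p of the algebra of smooth functions. Being a
  total function in HOL, it is set to 0 on all other functions, so that equality in HOL is
  equality of derivations.\<close>

type_synonym 'a tvec = "('a \<Rightarrow> real) \<Rightarrow> real"
type_synonym 'a vfield = "'a \<Rightarrow> 'a tvec"

definition scale_tvec :: "real \<Rightarrow> 'a tvec \<Rightarrow> 'a tvec" (infixr "*\<^sub>t" 75) where
  "c *\<^sub>t v = (\<lambda>f. c * v f)"

definition scale_vfield :: "('a \<Rightarrow> real) \<Rightarrow> 'a vfield \<Rightarrow> 'a vfield" (infixr "*\<^sub>f" 75) where
  "f *\<^sub>f X = (\<lambda>p. f p *\<^sub>t X p)"

definition tangent_space ::
  "('a::topological_space, 'e::euclidean_space) atlas \<Rightarrow> 'a \<Rightarrow> 'a tvec set" where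
  "tangent_space A p = {v.
     (\<forall>f\<in>smooth_functions A. \<forall>h\<in>smooth_functions A. v (f + h) = v f + v h) \<and>
     (\<forall>c. \<forall>f\<in>smooth_functions A. v (\<lambda>q. c * f q) = c * v f) \<and>
     (\<forall>f\<in>smooth_functions A. \<forall>h\<in>smooth_functions A. v (f * h) = f p * v h + h p * v f) \<and>
     (\<forall>f. f \<notin> smooth_functions A \<longrightarrow> v f = 0)}"

definition apply_vfield :: "'a vfield \<Rightarrow> ('a \<Rightarrow> real) \<Rightarrow> ('a \<Rightarrow> real)" where
  "apply_vfield X f = (\<lambda>p. X p f)"

definition vector_fields ::
  "('a::topological_space, 'e::euclidean_space) atlas \<Rightarrow> 'a vfield set" where
  "vector_fields A = {X. (\<forall>p. X p \<in> tangent_space A p) \<and>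
     (\<forall>f\<in>smooth_functions A. apply_vfield X f \<in> smooth_functions A)}"

definition lie_bracket :: "'a vfield \<Rightarrow> 'a vfield \<Rightarrow> 'a vfield" where
  "lie_bracket X Y = (\<lambda>p f. X p (apply_vfield Y f) - Y p (apply_vfield X f))"

section \<open>Tensor fields\<close>

text \<open>Tensor fields are given pointwise on the tangent spaces; smoothness is tested on smooth
  vector fields.\<close>

type_synonym 'a endo_field = "'a \<Rightarrow> 'a tvec \<Rightarrow> 'a tvec"
type_synonym 'a form_field = "'a \<Rightarrow> 'a tvec \<Rightarrow> 'a tvec \<Rightarrow> real"

definition endo_apply :: "'a endo_field \<Rightarrow> 'a vfield \<Rightarrow> 'a vfield" (infixr "\<bullet>\<^sub>e" 80) where
  "J \<bullet>\<^sub>e X = (\<lambda>p. J p (X p))"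

definition form_apply :: "'a form_field \<Rightarrow> 'a vfield \<Rightarrow> 'a vfield \<Rightarrow> ('a \<Rightarrow> real)" where
  "form_apply g X Y = (\<lambda>p. g p (X p) (Y p))"

definition tensor_1_1 ::
  "('a::topological_space, 'e::euclidean_space) atlas \<Rightarrow> 'a endo_field \<Rightarrow> bool" where
  "tensor_1_1 A J \<longleftrightarrow>
     (\<forall>p. \<forall>u\<in>tangent_space A p.
        J p u \<in> tangent_space A p \<and>
        (\<forall>v\<in>tangent_space A p. J p (u + v) = J p u + J p v) \<and>
        (\<forall>c. J p (c *\<^sub>t u) = c *\<^sub>t J p u)) \<and>
     (\<forall>X\<in>vector_fields A. J \<bullet>\<^sub>e X \<in> vector_fields A)"

definition tensor_0_2 ::
  "('a::topological_space, 'e::euclidean_space) atlas \<Rightarrow> 'a form_field \<Rightarrow> bool" where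
  "tensor_0_2 A g \<longleftrightarrow>
     (\<forall>p. \<forall>u\<in>tangent_space A p. \<forall>v\<in>tangent_space A p.
        (\<forall>w\<in>tangent_space A p.
           g p (u + v) w = g p u w + g p v w \<and> g p w (u + v) = g p w u + g p w v) \<and>
        (\<forall>c. g p (c *\<^sub>t u) v = c * g p u v \<and> g p u (c *\<^sub>t v) = c * g p u v)) \<and>
     (\<forall>X\<in>vector_fields A. \<forall>Y\<in>vector_fields A. form_apply g X Y \<in> smooth_functions A)"

definition pseudo_riemannian_metric ::
  "('a::topological_space, 'e::euclidean_space) atlas \<Rightarrow> 'a form_field \<Rightarrow> bool" where
  "pseudo_riemannian_metric A g \<longleftrightarrow>
     tensor_0_2 A g \<and>
     (\<forall>p. \<forall>u\<in>tangent_space A p. \<forall>v\<in>tangent_space A p. g p u v = g p v u) \<and>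
     (\<forall>p. \<forall>u\<in>tangent_space A p. (\<forall>v\<in>tangent_space A p. g p u v = 0) \<longrightarrow> u = 0)"

section \<open>The Levi-Civita connection and curvature\<close>

type_synonym 'a connection = "'a vfield \<Rightarrow> 'a vfield \<Rightarrow> 'a vfield"

definition affine_connection ::
  "('a::topological_space, 'e::euclidean_space) atlas \<Rightarrow> 'a connection \<Rightarrow> bool" where
  "affine_connection A D \<longleftrightarrow>
     (\<forall>X\<in>vector_fields A. \<forall>Y\<in>vector_fields A.
        D X Y \<in> vector_fields A \<and>
        (\<forall>Z\<in>vector_fields A. D (X + Y) Z = D X Z + D Y Z \<and> D Z (X + Y) = D Z X + D Z Y) \<and>
        (\<forall>f\<in>smooth_functions A.
           D (f *\<^sub>f X) Y = f *\<^sub>f D X Y \<and>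
           D X (f *\<^sub>f Y) = apply_vfield X f *\<^sub>f Y + f *\<^sub>f D X Y))"

definition levi_civita ::
  "('a::topological_space, 'e::euclidean_space) atlas \<Rightarrow> 'a form_field \<Rightarrow> 'a connection \<Rightarrow> bool"
  where
  "levi_civita A g D \<longleftrightarrow>
     affine_connection A D \<and>
     (\<forall>X\<in>vector_fields A. \<forall>Y\<in>vector_fields A. D X Y - D Y X = lie_bracket X Y) \<and>
     (\<forall>X\<in>vector_fields A. \<forall>Y\<in>vector_fields A. \<forall>Z\<in>vector_fields A.
        apply_vfield X (form_apply g Y Z) = form_apply g (D X Y) Z + form_apply g Y (D X Z))"

definition curvature :: "'a connection \<Rightarrow> 'a vfield \<Rightarrow> 'a vfield \<Rightarrow> 'a vfield \<Rightarrow> 'a vfield" where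
  "curvature D X Y Z = D X (D Y Z) - D Y (D X Z) - D (lie_bracket X Y) Z"

section \<open>Norden metrics and quasi-Kaehler manifolds\<close>

definition almost_complex_norden ::
  "('a::{t2_space, second_countable_topology}, 'e::euclidean_space) atlas
     \<Rightarrow> 'a endo_field \<Rightarrow> 'a form_field \<Rightarrow> bool" where
  "almost_complex_norden A J g \<longleftrightarrow>
     smooth_manifold A \<and> even DIM('e) \<and>
     tensor_1_1 A J \<and> pseudo_riemannian_metric A g \<and>
     (\<forall>X\<in>vector_fields A. J \<bullet>\<^sub>e (J \<bullet>\<^sub>e X) = - X) \<and>
     (\<forall>X\<in>vector_fields A. \<forall>Y\<in>vector_fields A.
        form_apply g (J \<bullet>\<^sub>e X) (J \<bullet>\<^sub>e Y) = - form_apply g X Y)"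

definition associated_metric :: "'a endo_field \<Rightarrow> 'a form_field \<Rightarrow> 'a form_field" where
  "associated_metric J g = (\<lambda>p u v. g p u (J p v))"

definition nabla_J :: "'a connection \<Rightarrow> 'a endo_field \<Rightarrow> 'a vfield \<Rightarrow> 'a vfield \<Rightarrow> 'a vfield" where
  "nabla_J D J X Y = D X (J \<bullet>\<^sub>e Y) - J \<bullet>\<^sub>e D X Y"

definition F_tensor ::
  "'a form_field \<Rightarrow> 'a connection \<Rightarrow> 'a endo_field
     \<Rightarrow> 'a vfield \<Rightarrow> 'a vfield \<Rightarrow> 'a vfield \<Rightarrow> ('a \<Rightarrow> real)" where
  "F_tensor g D J X Y Z = form_apply g (nabla_J D J X Y) Z"

text \<open>The Levi-Civita connection exists and is unique by the fundamental theorem of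
  pseudo-Riemannian geometry; D below ranges over that one connection.\<close>

definition quasi_kaehler_norden ::
  "('a::{t2_space, second_countable_topology}, 'e::euclidean_space) atlas
     \<Rightarrow> 'a endo_field \<Rightarrow> 'a form_field \<Rightarrow> bool" where
  "quasi_kaehler_norden A J g \<longleftrightarrow>
     almost_complex_norden A J g \<and>
     (\<forall>D. levi_civita A g D \<longrightarrow>
       (\<forall>X\<in>vector_fields A. \<forall>Y\<in>vector_fields A. \<forall>Z\<in>vector_fields A.
          F_tensor g D J X Y Z + F_tensor g D J Y Z X + F_tensor g D J Z X Y = 0))"

definition T_tensor :: "'a connection \<Rightarrow> 'a endo_field \<Rightarrow> 'a vfield \<Rightarrow> 'a vfield \<Rightarrow> 'a vfield" where
  "T_tensor D J X Y = nabla_J D J X (J \<bullet>\<^sub>e Y) + nabla_J D J Y (J \<bullet>\<^sub>e X)"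

definition nabla_T ::
  "'a connection \<Rightarrow> 'a endo_field \<Rightarrow> 'a vfield \<Rightarrow> 'a vfield \<Rightarrow> 'a vfield \<Rightarrow> 'a vfield" where
  "nabla_T D J X Y Z =
     D X (T_tensor D J Y Z) - T_tensor D J (D X Y) Z - T_tensor D J Y (D X Z)"

definition Q_tensor ::
  "'a connection \<Rightarrow> 'a endo_field \<Rightarrow> 'a vfield \<Rightarrow> 'a vfield \<Rightarrow> 'a vfield \<Rightarrow> 'a vfield" where
  "Q_tensor D J X Y Z =
     nabla_T D J X Y Z - nabla_T D J Y X Z
     + T_tensor D J X (T_tensor D J Y Z) - T_tensor D J Y (T_tensor D J X Z)"

definition S_connection :: "'a connection \<Rightarrow> 'a endo_field \<Rightarrow> 'a connection" where
  "S_connection D J X Y = D X Y + (\<lambda>_. 1/2) *\<^sub>f T_tensor D J X Y"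

definition P_tensor ::
  "'a connection \<Rightarrow> 'a endo_field \<Rightarrow> 'a vfield \<Rightarrow> 'a vfield \<Rightarrow> 'a vfield \<Rightarrow> 'a vfield" where
  "P_tensor D J X Y Z = curvature D X Y Z + (\<lambda>_. 1/2) *\<^sub>f Q_tensor D J X Y Z"

end

theory Submission
  imports Defs "HOL-Computational_Algebra.Polynomial"
begin

text \<open>
  Put \<Phi>(X,Y) = D' X Y - D X Y, a symmetric tensor since both connections are torsion-free.
  Differentiating g(Y,JZ) with both connections gives
  g(J\<Phi>(X,Y),Z) + g(J\<Phi>(X,Z),Y) = F(X,Y,Z). Solving this as in the Koszul formula and using the
  vanishing cyclic sum of F yields J\<Phi>(X,Y) = (D_X J)Y + (D_Y J)X, which amounts to \<Phi> = T.
  The metric associated with g' is -g, whose Levi-Civita connection is again D; so the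
  same argument for g' gives D = D' + T', that is T' = -T. Finally D' = D + T implies R' = R + Q, and
  symmetrically R = R' + Q'. Both invariants are the midpoints of the two descriptions.

  Passing from g(W,Y) = 0 for all vector fields Y to W = 0 requires that every derivation at a
  point is the value of a global vector field, which rests on Hadamard's lemma and bump functions.
\<close>

section \<open>Smooth functions on Euclidean space\<close>

lemma C_k_on_Suc_imp: "C_k_on (Suc k) S f \<Longrightarrow> C_k_on k S f"
proof (induction k arbitrary: f)
  case 0
  then show ?case
    by (auto intro!: continuous_at_imp_continuous_on differentiable_imp_continuous_within)
next
  case (Suc k)
  then show ?case
    unfolding C_k_on.simps(2)[of "Suc k"] C_k_on.simps(2)[of "k" S f] by blast
qed

lemma C_k_on_imp_continuous_on: "C_k_on k S f \<Longrightarrow> continuous_on S f"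
proof (induction k)
  case (Suc k)
  then show ?case using C_k_on_Suc_imp by blast
qed simp

text \<open>Derivatives are taken with \<open>at x\<close>, so inside an open set they depend only
  on values in that set. The derivatives of \<open>f\<close> and \<open>h\<close> therefore agree on
  \<open>S\<close>, and the induction applies to them.\<close>

lemma C_k_on_cong:
  assumes "open S" "\<And>x. x \<in> S \<Longrightarrow> f x = h x" "C_k_on k S f"
  shows "C_k_on k S h"
  using assms(2,3)
proof (induction k arbitrary: f h)
  case 0
  then show ?case using continuous_on_cong[of S S f h] by simp
next
  case (Suc k)
  have D: "(h has_derivative frechet_derivative f (at x)) (at x)" if x: "x \<in> S" for x
  proof -
    have "(f has_derivative frechet_derivative f (at x)) (at x)"
      using Suc.prems(2) x by (simp add: frechet_derivative_works[symmetric])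
    then show ?thesis
      by (rule has_derivative_transform_within_open[OF _ assms(1) x Suc.prems(1)])
  qed
  have "frechet_derivative f (at x) v = frechet_derivative h (at x) v" if "x \<in> S" for x v
    using frechet_derivative_at[OF D[OF that]] by simp
  then have "C_k_on k S (\<lambda>x. frechet_derivative h (at x) v)" for v
    using Suc.IH[of "\<lambda>x. frechet_derivative f (at x) v" "\<lambda>x. frechet_derivative h (at x) v"]
      Suc.prems(2) by simp
  then show ?case using D by (auto simp: differentiable_def)
qed

text \<open>\<open>frechet_derivative\<close> is a choice operator; uniqueness of derivatives lets
  an explicit formula \<open>f'\<close> stand for it in the proofs below.\<close>

lemma C_k_on_SucI:
  assumes "open S" "\<And>x. x \<in> S \<Longrightarrow> (f has_derivative f' x) (at x)"
    "\<And>v. C_k_on k S (\<lambda>x. f' x v)"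
  shows "C_k_on (Suc k) S f"
proof -
  have "f' x v = frechet_derivative f (at x) v" if "x \<in> S" for x v
    using frechet_derivative_at[OF assms(2)[OF that]] by simp
  then have "C_k_on k S (\<lambda>x. frechet_derivative f (at x) v)" for v
    by (intro C_k_on_cong[OF assms(1) _ assms(3)[of v]]) blast
  moreover have "f differentiable (at x)" if "x \<in> S" for x
    using assms(2)[OF that] by (rule differentiableI)
  ultimately show ?thesis by simp
qed

lemma C_k_on_SucD:
  assumes "C_k_on (Suc k) S f"
  shows "x \<in> S \<Longrightarrow> (f has_derivative frechet_derivative f (at x)) (at x)"
    and "C_k_on k S (\<lambda>x. frechet_derivative f (at x) v)"
  using assms unfolding C_k_on.simps frechet_derivative_works by blast+

lemma C_k_on_subset: "C_k_on k S f \<Longrightarrow> T \<subseteq> S \<Longrightarrow> C_k_on k T f"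
proof (induction k arbitrary: f)
  case (Suc k)
  then show ?case unfolding C_k_on.simps by blast
qed (auto intro: continuous_on_subset)

text \<open>Continuity and differentiability at a point only involve a neighbourhood. This is what
  later allows smoothness of a glued function to be checked by cases.\<close>

lemma C_k_on_locally:
  assumes "\<And>x. x \<in> S \<Longrightarrow> \<exists>N. open N \<and> x \<in> N \<and> C_k_on k N f"
  shows "C_k_on k S f"
  using assms
proof (induction k arbitrary: f)
  case 0
  show ?case unfolding C_k_on.simps(1)
  proof (rule continuous_at_imp_continuous_on, rule ballI)
    fix x assume "x \<in> S"
    then obtain N where "open N" "x \<in> N" "C_k_on 0 N f" using 0 by blast
    then show "isCont f x" using continuous_on_eq_continuous_at[of N f] by simp
  qed
next
  case (Suc k)
  have "\<exists>N. open N \<and> x \<in> N \<and> C_k_on k N (\<lambda>x. frechet_derivative f (at x) v)"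
    and "f differentiable (at x)" if x: "x \<in> S" for x v
  proof -
    obtain N where N: "open N" "x \<in> N" "C_k_on (Suc k) N f" using Suc.prems[OF x] by blast
    show "\<exists>N. open N \<and> x \<in> N \<and> C_k_on k N (\<lambda>x. frechet_derivative f (at x) v)"
      using N C_k_on_SucD(2)[OF N(3), of v] by blast
    show "f differentiable (at x)"
      using N by simp
  qed
  then show ?case unfolding C_k_on.simps using Suc.IH by blast
qed

lemma C_k_on_const: "open S \<Longrightarrow> C_k_on k S (\<lambda>x. c)"
proof (induction k arbitrary: c)
  case (Suc k)
  show ?case by (rule C_k_on_SucI[where f' = "\<lambda>_ _. 0"]) (use Suc in auto)
qed simp

lemma C_k_on_bounded_linear: "open S \<Longrightarrow> bounded_linear f \<Longrightarrow> C_k_on k S f"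
proof (cases k)
  case (Suc k)
  assume *: "open S" "bounded_linear f"
  show ?thesis unfolding Suc
    by (rule C_k_on_SucI[where f' = "\<lambda>_. f"])
      (use * in \<open>auto intro: C_k_on_const bounded_linear_imp_has_derivative\<close>)
qed (auto intro: linear_continuous_on)

lemma C_k_on_add:
  assumes "open S" "C_k_on k S f" "C_k_on k S h"
  shows "C_k_on k S (\<lambda>x. f x + h x)"
  using assms(2,3)
proof (induction k arbitrary: f h)
  case (Suc k)
  show ?case
    by (rule C_k_on_SucI[OF assms(1) has_derivative_add[OF C_k_on_SucD(1) C_k_on_SucD(1)]])
      (use Suc.prems in \<open>auto intro: Suc.IH\<close>)
qed (auto intro: continuous_intros)

lemma C_k_on_sum:
  assumes "open S" "\<And>i. i \<in> I \<Longrightarrow> C_k_on k S (f i)"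
  shows "C_k_on k S (\<lambda>x. \<Sum>i\<in>I. f i x)"
  using assms(2)
  by (induction I rule: infinite_finite_induct)
    (auto intro: C_k_on_const C_k_on_add assms(1))

text \<open>The Leibniz rule works for any bounded bilinear map, which covers multiplication,
  scaling and inner products at once. The undifferentiated factor is used at order \<open>k\<close>
  only, hence \<open>C_k_on_Suc_imp\<close>.\<close>

lemma (in bounded_bilinear) C_k_on_prod:
  assumes "open S" "C_k_on k S f" "C_k_on k S h"
  shows "C_k_on k S (\<lambda>x. prod (f x) (h x))"
  using assms(2,3)
proof (induction k arbitrary: f h)
  case 0
  then show ?case by (auto intro: continuous_on)
next
  case (Suc k)
  show ?case
    by (rule C_k_on_SucI[OF assms(1) FDERIV[OF C_k_on_SucD(1)[OF Suc.prems(1)]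
            C_k_on_SucD(1)[OF Suc.prems(2)]]])
      (assumption | intro C_k_on_add[OF assms(1)] Suc.IH C_k_on_SucD(2)[OF Suc.prems(1)]
        C_k_on_SucD(2)[OF Suc.prems(2)] C_k_on_Suc_imp[OF Suc.prems(1)] C_k_on_Suc_imp[OF Suc.prems(2)])+
qed

text \<open>The chain rule differentiates \<open>h\<close> in the direction \<open>?f' x v\<close>,
  which varies with \<open>x\<close>, whereas \<open>C_k_on\<close> speaks of fixed directions.
  Expanding that direction over \<open>Basis\<close> leaves fixed directions with scalar
  coefficients, which is why the middle space is Euclidean.\<close>

lemma C_k_on_compose:
  fixes f :: "'d::real_normed_vector \<Rightarrow> 'e::euclidean_space"
  assumes "open S" "open T" "C_k_on k S f" "C_k_on k T h" "f ` S \<subseteq> T"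
  shows "C_k_on k S (\<lambda>x. h (f x))"
  using assms(3,4)
proof (induction k arbitrary: h)
  case 0
  then show ?case using assms(5) by (auto intro: continuous_on_compose2)
next
  case (Suc k)
  let ?f' = "\<lambda>x. frechet_derivative f (at x)" and ?h' = "\<lambda>x. frechet_derivative h (at x)"
  let ?D = "\<lambda>x v. \<Sum>b\<in>Basis. (?f' x v \<bullet> b) *\<^sub>R ?h' (f x) b"
  have "((\<lambda>x. h (f x)) has_derivative ?D x) (at x)" if x: "x \<in> S" for x
  proof -
    have h: "(h has_derivative ?h' (f x)) (at (f x))"
      using C_k_on_SucD(1)[OF Suc.prems(2), of "f x"] x assms(5) by blast
    have lin: "linear (?h' (f x))"
      using h has_derivative_linear by blast
    have "?h' (f x) w = (\<Sum>b\<in>Basis. (w \<bullet> b) *\<^sub>R ?h' (f x) b)" for w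
      using linear_sum[OF lin, of "\<lambda>b. (w \<bullet> b) *\<^sub>R b" Basis] linear_cmul[OF lin]
      by (simp add: euclidean_representation)
    then have "?D x = (\<lambda>v. ?h' (f x) (?f' x v))" by (intro ext) (rule sym)
    then show ?thesis
      using has_derivative_compose[OF C_k_on_SucD(1)[OF Suc.prems(1) x] h] by simp
  qed
  moreover have "C_k_on k S (\<lambda>x. ?D x v)" for v
  proof (intro C_k_on_sum bounded_bilinear.C_k_on_prod[OF bounded_bilinear_scaleR]
      bounded_bilinear.C_k_on_prod[OF bounded_bilinear_inner] C_k_on_const assms(1))
    show "C_k_on k S (\<lambda>x. ?f' x v)" using C_k_on_SucD(2)[OF Suc.prems(1)] .
    show "C_k_on k S (\<lambda>x. ?h' (f x) b)" for b
      using Suc.IH[OF C_k_on_Suc_imp[OF Suc.prems(1)] C_k_on_SucD(2)[OF Suc.prems(2)]] .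
  qed
  ultimately show ?case by (rule C_k_on_SucI[OF assms(1)])
qed

lemma smooth_on_cong: "open S \<Longrightarrow> (\<And>x. x \<in> S \<Longrightarrow> f x = h x) \<Longrightarrow> smooth_on S f \<Longrightarrow> smooth_on S h"
  unfolding smooth_on_def using C_k_on_cong[of S f h] by blast

lemma smooth_on_subset: "smooth_on S f \<Longrightarrow> T \<subseteq> S \<Longrightarrow> smooth_on T f"
  unfolding smooth_on_def using C_k_on_subset by blast

lemma smooth_on_locally:
  "(\<And>x. x \<in> S \<Longrightarrow> \<exists>N. open N \<and> x \<in> N \<and> smooth_on N f) \<Longrightarrow> smooth_on S f"
  unfolding smooth_on_def by (intro allI C_k_on_locally) blast

lemma smooth_on_const: "open S \<Longrightarrow> smooth_on S (\<lambda>x. c)"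
  unfolding smooth_on_def by (simp add: C_k_on_const)

lemma smooth_on_bounded_linear: "open S \<Longrightarrow> bounded_linear f \<Longrightarrow> smooth_on S f"
  unfolding smooth_on_def by (simp add: C_k_on_bounded_linear)

lemma smooth_on_add: "open S \<Longrightarrow> smooth_on S f \<Longrightarrow> smooth_on S h \<Longrightarrow> smooth_on S (\<lambda>x. f x + h x)"
  unfolding smooth_on_def by (simp add: C_k_on_add)

lemma smooth_on_sum:
  "open S \<Longrightarrow> (\<And>i. i \<in> I \<Longrightarrow> smooth_on S (f i)) \<Longrightarrow> smooth_on S (\<lambda>x. \<Sum>i\<in>I. f i x)"
  unfolding smooth_on_def by (simp add: C_k_on_sum)

lemma smooth_on_mult:
  fixes f h :: "'e::real_normed_vector \<Rightarrow> real"
  shows "open S \<Longrightarrow> smooth_on S f \<Longrightarrow> smooth_on S h \<Longrightarrow> smooth_on S (\<lambda>x. f x * h x)"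
  unfolding smooth_on_def by (simp add: bounded_bilinear.C_k_on_prod[OF bounded_bilinear_mult])

lemma smooth_on_inner:
  fixes f h :: "'e::real_normed_vector \<Rightarrow> 'f::real_inner"
  shows "open S \<Longrightarrow> smooth_on S f \<Longrightarrow> smooth_on S h \<Longrightarrow> smooth_on S (\<lambda>x. f x \<bullet> h x)"
  unfolding smooth_on_def by (simp add: bounded_bilinear.C_k_on_prod[OF bounded_bilinear_inner])

lemma smooth_on_compose:
  fixes f :: "'d::real_normed_vector \<Rightarrow> 'e::euclidean_space"
  shows "open S \<Longrightarrow> open T \<Longrightarrow> smooth_on S f \<Longrightarrow> smooth_on T h \<Longrightarrow> f ` S \<subseteq> T
    \<Longrightarrow> smooth_on S (\<lambda>x. h (f x))"
  unfolding smooth_on_def by (simp add: C_k_on_compose)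

lemma smooth_on_has_derivative:
  "smooth_on S f \<Longrightarrow> x \<in> S \<Longrightarrow> (f has_derivative frechet_derivative f (at x)) (at x)"
  unfolding smooth_on_def using C_k_on_SucD(1) by blast

lemma smooth_on_frechet_derivative:
  "smooth_on S f \<Longrightarrow> smooth_on S (\<lambda>x. frechet_derivative f (at x) v)"
  unfolding smooth_on_def using C_k_on_SucD(2) by blast

lemma smooth_on_imp_continuous_on: "smooth_on S f \<Longrightarrow> continuous_on S f"
  unfolding smooth_on_def using C_k_on.simps(1) by blast

section \<open>Flat functions and bump functions\<close>

lemma poly_div_exp_tendsto_0:
  "((\<lambda>s::real. poly p s / exp s) \<longlongrightarrow> 0) at_top"
proof -
  have "((\<lambda>s. \<Sum>i\<le>degree p. coeff p i * (s ^ i / exp s)) \<longlongrightarrow> (\<Sum>i\<le>degree p. coeff p i * 0)) at_top"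
    by (intro tendsto_intros tendsto_power_div_exp_0)
  then show ?thesis by (simp add: poly_altdef sum_divide_distrib)
qed

text \<open>Allowing polynomial factors in 1/t makes this family closed under differentiation.\<close>

definition flat :: "real poly \<Rightarrow> real \<Rightarrow> real" where
  "flat p t = (if t > 0 then poly p (1 / t) * exp (- (1 / t)) else 0)"

text \<open>With s = 1/t, the chain rule turns p(s) exp(-s) into s^2 (p(s) - p'(s)) exp(-s) for
  positive t. At 0 the left difference quotient vanishes, and the right one tends to 0 because exp
  outgrows every polynomial.\<close>

lemma flat_has_real_derivative:
  "(flat p has_real_derivative flat (monom 1 2 * (p - pderiv p)) t) (at t)"
proof -
  consider "t > 0" | "t < 0" | "t = 0" by linarith
  then show ?thesis
  proof cases
    case 1
    have "((\<lambda>t. poly p (1 / t) * exp (- (1 / t))) has_real_derivative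
       flat (monom 1 2 * (p - pderiv p)) t) (at t)"
      using 1 by (auto intro!: derivative_eq_intros DERIV_chain2[OF poly_DERIV]
          simp: flat_def poly_monom field_simps power2_eq_square)
    then show ?thesis
      by (rule has_field_derivative_transform_within_open[where S = "{0<..}"])
        (use 1 in \<open>auto simp: flat_def\<close>)
  next
    case 2
    have "((\<lambda>t. 0) has_real_derivative flat (monom 1 2 * (p - pderiv p)) t) (at t)"
      using 2 by (simp add: flat_def)
    then show ?thesis
      by (rule has_field_derivative_transform_within_open[where S = "{..<0}"])
        (use 2 in \<open>auto simp: flat_def\<close>)
  next
    case 3
    \<comment> \<open>\<open>pCons 0 p\<close> is s p(s): the extra factor s = 1/h comes from
      dividing \<open>flat p h\<close> by h.\<close>
    have "((\<lambda>s. poly (pCons 0 p) s / exp s) \<longlongrightarrow> 0) at_top"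
      by (rule poly_div_exp_tendsto_0)
    then have "((\<lambda>h. poly (pCons 0 p) (inverse h) / exp (inverse h)) \<longlongrightarrow> 0) (at_right 0)"
      by (rule filterlim_compose[OF _ filterlim_inverse_at_top_right])
    then have "((\<lambda>h. flat p h / h) \<longlongrightarrow> 0) (at_right 0)"
      by (rule Lim_transform_eventually)
        (auto simp: eventually_at_filter flat_def exp_minus field_simps)
    moreover have "((\<lambda>h. flat p h / h) \<longlongrightarrow> 0) (at_left 0)"
      by (rule Lim_transform_eventually[OF tendsto_const])
        (auto simp: eventually_at_filter flat_def)
    ultimately have "((\<lambda>h. flat p h / h) \<longlongrightarrow> 0) (at 0)"
      by (simp add: filterlim_split_at)
    then show ?thesis using 3 by (simp add: DERIV_def flat_def)
  qed
qed

text \<open>The derivative of a member of the family is again a member, so the induction on the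
  order runs over all \<open>p\<close> simultaneously.\<close>

lemma smooth_on_flat: "smooth_on UNIV (flat p)"
  unfolding smooth_on_def
proof
  fix k show "C_k_on k UNIV (flat p)"
  proof (induction k arbitrary: p)
    case 0
    show ?case
      unfolding C_k_on.simps
      by (intro continuous_at_imp_continuous_on ballI DERIV_isCont[OF flat_has_real_derivative])
  next
    case (Suc k)
    show ?case
      by (rule C_k_on_SucI[OF open_UNIV flat_has_real_derivative[unfolded has_field_derivative_def]])
        (intro bounded_bilinear.C_k_on_prod[OF bounded_bilinear_mult] Suc.IH C_k_on_const open_UNIV)
  qed
qed

lemma bump_function:
  fixes a :: "'e::euclidean_space"
  assumes "r > 0"
  obtains \<beta> :: "'e \<Rightarrow> real" where "smooth_on UNIV \<beta>" "\<beta> a = 1" "\<And>x. x \<notin> cball a r \<Longrightarrow> \<beta> x = 0"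
proof
  \<comment> \<open>The argument of the first \<open>flat 1\<close> is positive exactly on the open
    ball of radius \<open>r\<close>; the constant factor normalises the value at \<open>a\<close>.
    Subtraction is written as adding a multiple by -1 so that the rules for sums and products
    apply.\<close>
  let ?\<beta> = "\<lambda>x. flat 1 (r\<^sup>2 + (- 1) * ((x - a) \<bullet> (x - a))) * (1 / flat 1 (r\<^sup>2))"
  have id: "smooth_on UNIV (\<lambda>x. x + (- a))"
    by (intro smooth_on_add smooth_on_const smooth_on_bounded_linear) auto
  show "smooth_on UNIV ?\<beta>"
    by (intro smooth_on_mult smooth_on_const smooth_on_compose[OF _ _ _ smooth_on_flat]
        smooth_on_add smooth_on_inner) (use id in auto)
  show "?\<beta> a = 1" using assms by (simp add: flat_def)
  show "?\<beta> x = 0" if "x \<notin> cball a r" for x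
  proof -
    have "r < norm (x - a)" using that by (simp add: dist_norm norm_minus_commute)
    then have "r\<^sup>2 \<le> (norm (x - a))\<^sup>2" using assms by (intro power_mono) auto
    then show ?thesis by (simp add: flat_def dot_square_norm)
  qed
qed

section \<open>Hadamard's lemma on a ball\<close>

lemma radial_segment_in_ball:
  fixes x :: "'e::real_normed_vector"
  assumes "x \<in> ball a r" "t \<in> {0..1}"
  shows "a + t *\<^sub>R (x - a) \<in> ball a r"
proof -
  have "norm (t *\<^sub>R (x - a)) \<le> norm (x - a)"
    using assms(2) by (simp add: mult_left_le_one_le)
  then show ?thesis using assms(1) by (simp add: dist_norm norm_minus_commute)
qed

text \<open>The power of t is arbitrary because each differentiation under the integral
  contributes one more factor t.\<close>

lemma C_k_on_integral:
  fixes h :: "'e::euclidean_space \<Rightarrow> real"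
  assumes "C_k_on k (ball a r) h"
  shows "C_k_on k (ball a r) (\<lambda>x. integral (cbox 0 1) (\<lambda>t::real. t ^ m * h (a + t *\<^sub>R (x - a))))"
proof -
  have seg: "a + t *\<^sub>R (x - a) \<in> ball a r" if "x \<in> ball a r" "t \<in> cbox 0 1" for x t
    using radial_segment_in_ball that by simp
  have cont: "continuous_on (ball a r \<times> cbox 0 1) (\<lambda>(x, t). t ^ m * h (a + t *\<^sub>R (x - a)))"
    if "continuous_on (ball a r) h" for h :: "'e \<Rightarrow> real" and m
    unfolding case_prod_unfold
    by (intro continuous_intros continuous_on_compose2[OF that])
      (use seg in \<open>auto simp del: mem_ball\<close>)
  show ?thesis
    using assms
  proof (induction k arbitrary: m h)
    case 0
    then show ?case
      unfolding C_k_on.simps by (rule integral_continuous_on_param[OF cont])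
  next
    case (Suc k)
    let ?h' = "\<lambda>x. frechet_derivative h (at x)"
    \<comment> \<open>This is the derivative of the integrand in \<open>x\<close>, packed as a
      bounded linear map because \<open>leibniz_rule\<close> expects one. The inner map x |-> a + t
      (x - a) contributes the factor t that raises \<open>m\<close> to \<open>Suc m\<close>.\<close>
    define fx where "fx x t = Blinfun (\<lambda>v. t ^ Suc m * ?h' (a + t *\<^sub>R (x - a)) v)" for x and t :: real
    have lin: "bounded_linear (\<lambda>v. t ^ Suc m * ?h' (a + t *\<^sub>R (x - a)) v)"
      if "x \<in> ball a r" "t \<in> cbox 0 1" for x t
      using has_derivative_bounded_linear[OF C_k_on_SucD(1)[OF Suc.prems seg[OF that]]]
      by (rule bounded_linear_const_mult)
    have fx: "blinfun_apply (fx x t) v = t ^ Suc m * ?h' (a + t *\<^sub>R (x - a)) v"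
      if "x \<in> ball a r" "t \<in> cbox 0 1" for x t v
      unfolding fx_def using bounded_linear_Blinfun_apply[OF lin[OF that]] by simp
    have hc: "continuous_on (ball a r) h" "continuous_on (ball a r) (\<lambda>x. ?h' x v)" for v
      by (rule C_k_on_imp_continuous_on[OF Suc.prems])
        (rule C_k_on_imp_continuous_on[OF C_k_on_SucD(2)[OF Suc.prems]])
    have contfx: "continuous_on (ball a r \<times> cbox 0 1) (\<lambda>(x, t). fx x t)"
    proof (rule continuous_on_blinfun_componentwise)
      fix i :: 'e assume "i \<in> Basis"
      show "continuous_on (ball a r \<times> cbox 0 1) (\<lambda>z. blinfun_apply (case z of (x, t) \<Rightarrow> fx x t) i)"
        by (rule continuous_on_eq[OF cont[OF hc(2)[of i], of "Suc m"]]) (auto simp: fx)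
    qed
    have der: "((\<lambda>x. integral (cbox 0 1) (\<lambda>t. t ^ m * h (a + t *\<^sub>R (x - a)))) has_derivative
        blinfun_apply (integral (cbox 0 1) (fx x0))) (at x0)" if x0: "x0 \<in> ball a r" for x0
    proof -
      have "((\<lambda>x. integral (cbox 0 1) (\<lambda>t. t ^ m * h (a + t *\<^sub>R (x - a)))) has_derivative
        blinfun_apply (integral (cbox 0 1) (fx x0))) (at x0 within ball a r)"
      proof (rule leibniz_rule[OF _ _ contfx x0 convex_ball])
        fix x and t :: real assume xt: "x \<in> ball a r" "t \<in> cbox 0 1"
        have "((\<lambda>x. a + t *\<^sub>R (x - a)) has_derivative (\<lambda>v. t *\<^sub>R v)) (at x)"
          by (auto intro!: derivative_eq_intros)
        from has_derivative_compose[OF this C_k_on_SucD(1)[OF Suc.prems seg[OF xt]]]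
        have "((\<lambda>x. t ^ m * h (a + t *\<^sub>R (x - a))) has_derivative
            (\<lambda>v. t ^ m * ?h' (a + t *\<^sub>R (x - a)) (t *\<^sub>R v))) (at x)"
          by (rule has_derivative_mult_right)
        moreover have "(\<lambda>v. t ^ m * ?h' (a + t *\<^sub>R (x - a)) (t *\<^sub>R v)) = blinfun_apply (fx x t)"
          using linear_cmul[OF has_derivative_linear[OF C_k_on_SucD(1)[OF Suc.prems seg[OF xt]]]]
          by (auto simp: fx[OF xt] algebra_simps)
        ultimately show "((\<lambda>x. t ^ m * h (a + t *\<^sub>R (x - a))) has_derivative blinfun_apply (fx x t))
            (at x within ball a r)"
          using has_derivative_at_withinI by metis
      next
        fix x assume x: "x \<in> ball a r"
        show "(\<lambda>t. t ^ m * h (a + t *\<^sub>R (x - a))) integrable_on cbox 0 1"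
          by (intro integrable_continuous continuous_intros continuous_on_compose2[OF hc(1)])
            (use seg[OF x] in blast)+
      qed
      then show ?thesis using at_within_open[OF x0] by simp
    qed
    \<comment> \<open>Evaluation at \<open>v\<close> commutes with the integral, so a directional
      derivative has the original shape, with a derivative of \<open>h\<close> in place of
      \<open>h\<close> and \<open>Suc m\<close> in place of \<open>m\<close>: the form needed for
      the induction hypothesis.\<close>
    have app: "blinfun_apply (integral (cbox 0 1) (fx x)) v
      = integral (cbox 0 1) (\<lambda>t. t ^ Suc m * ?h' (a + t *\<^sub>R (x - a)) v)" if x: "x \<in> ball a r" for x v
    proof -
      have "continuous_on (cbox 0 1) (\<lambda>t. (\<lambda>(x, t). fx x t) (x, t))"
        by (rule continuous_on_compose2[OF contfx]) (use x in \<open>auto intro!: continuous_intros\<close>)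
      then have "fx x integrable_on cbox 0 1"
        by (intro integrable_continuous) simp
      then have "blinfun_apply (integral (cbox 0 1) (fx x)) v = integral (cbox 0 1) (\<lambda>t. blinfun_apply (fx x t) v)"
        by (rule blinfun_apply_integral)
      also have "\<dots> = integral (cbox 0 1) (\<lambda>t. t ^ Suc m * ?h' (a + t *\<^sub>R (x - a)) v)"
        by (rule integral_cong) (use fx x in auto)
      finally show ?thesis .
    qed
    have C_k: "C_k_on k (ball a r) (\<lambda>x. blinfun_apply (integral (cbox 0 1) (fx x)) v)" for v
      by (rule C_k_on_cong[OF _ _ Suc.IH[OF C_k_on_SucD(2)[OF Suc.prems, of v], of "Suc m"]])
        (simp_all only: app open_ball)
    show ?case by (rule C_k_on_SucI[OF open_ball der C_k])
  qed
qed

text \<open>Integrate the derivative of t |-> f (a + t (x - a)) over the unit interval, expand the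
  direction x - a over \<open>Basis\<close>, and take the coefficients out of the integral.\<close>

lemma Hadamard:
  fixes f :: "'e::euclidean_space \<Rightarrow> real"
  assumes f: "smooth_on (ball a r) f"
  obtains h where "\<And>b. smooth_on (ball a r) (h b)"
    "\<And>b. h b a = frechet_derivative f (at a) b"
    "\<And>x. x \<in> ball a r \<Longrightarrow> f x = f a + (\<Sum>b\<in>Basis. ((x - a) \<bullet> b) * h b x)"
proof
  let ?f' = "\<lambda>x. frechet_derivative f (at x)"
  \<comment> \<open>The factor \<open>t ^ 0\<close> only serves to match
    \<open>C_k_on_integral\<close> with \<open>m\<close> = 0.\<close>
  let ?h = "\<lambda>b x. integral (cbox 0 1) (\<lambda>t::real. t ^ 0 * ?f' (a + t *\<^sub>R (x - a)) b)"
  show "smooth_on (ball a r) (?h b)" for b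
    using smooth_on_frechet_derivative[OF f, of b] C_k_on_integral[of _ a r _ 0]
    unfolding smooth_on_def by blast
  show "?h b a = ?f' a b" for b by simp
  show "f x = f a + (\<Sum>b\<in>Basis. ((x - a) \<bullet> b) * ?h b x)" if x: "x \<in> ball a r" for x
  proof -
    note seg = radial_segment_in_ball[OF x]
    have lin: "linear (?f' (a + t *\<^sub>R (x - a)))" if "t \<in> {0..1}" for t
      using smooth_on_has_derivative[OF f seg[OF that]] has_derivative_linear by blast
    have int: "(\<lambda>t. ?f' (a + t *\<^sub>R (x - a)) b) integrable_on {0..1}" for b
      by (intro integrable_continuous_real continuous_intros continuous_on_compose2
          [OF smooth_on_imp_continuous_on[OF smooth_on_frechet_derivative[OF f, of b]]])
        (use seg in auto)
    have "((\<lambda>t. f (a + t *\<^sub>R (x - a))) has_vector_derivative ?f' (a + t *\<^sub>R (x - a)) (x - a))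
        (at t within {0..1})" if t: "t \<in> {0..1}" for t
    proof -
      have "((\<lambda>t. a + t *\<^sub>R (x - a)) has_derivative (\<lambda>s. s *\<^sub>R (x - a))) (at t)"
        by (auto intro!: derivative_eq_intros)
      from has_derivative_compose[OF this smooth_on_has_derivative[OF f seg[OF t]]]
      show ?thesis using linear_cmul[OF lin[OF t]]
        by (auto simp: has_vector_derivative_def intro: has_derivative_at_withinI)
    qed
    then have "((\<lambda>t. ?f' (a + t *\<^sub>R (x - a)) (x - a)) has_integral
        (f (a + 1 *\<^sub>R (x - a)) - f (a + 0 *\<^sub>R (x - a)))) {0..1}"
      by (intro fundamental_theorem_of_calculus) auto
    then have "f x - f a = integral {0..1} (\<lambda>t. ?f' (a + t *\<^sub>R (x - a)) (x - a))"
      by (simp add: integral_unique)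
    also have "\<dots> = integral {0..1} (\<lambda>t. \<Sum>b\<in>Basis. ((x - a) \<bullet> b) * ?f' (a + t *\<^sub>R (x - a)) b)"
    proof (rule integral_cong)
      fix t :: real assume t: "t \<in> {0..1}"
      show "?f' (a + t *\<^sub>R (x - a)) (x - a) = (\<Sum>b\<in>Basis. ((x - a) \<bullet> b) * ?f' (a + t *\<^sub>R (x - a)) b)"
        using linear_sum[OF lin[OF t], of "\<lambda>b. ((x - a) \<bullet> b) *\<^sub>R b" Basis] linear_cmul[OF lin[OF t]]
        by (simp add: euclidean_representation)
    qed
    also have "\<dots> = (\<Sum>b\<in>Basis. ((x - a) \<bullet> b) * ?h b x)"
      by (subst integral_sum) (auto intro: integrable_on_mult_right int)
    finally show ?thesis by simp
  qed
qed

section \<open>Extending tangent vectors to vector fields\<close>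

lemma
  assumes "smooth_manifold A" "(U, \<phi>) \<in> A"
  shows manifold_chart_open: "open U" and manifold_chart_open_image: "open (\<phi> ` U)"
    and manifold_chart_homeomorphism: "homeomorphism U (\<phi> ` U) \<phi> (inv_into U \<phi>)"
  using assms unfolding smooth_manifold_def chart_def by blast+

lemma manifold_chart_inverse:
  assumes "smooth_manifold A" "(U, \<phi>) \<in> A"
  shows "q \<in> U \<Longrightarrow> inv_into U \<phi> (\<phi> q) = q"
  using manifold_chart_homeomorphism[OF assms] unfolding homeomorphism_def by blast

lemma manifold_chart_open_map:
  assumes "smooth_manifold A" "(U, \<phi>) \<in> A" "open W"
  shows "open (\<phi> ` (U \<inter> W))"
proof -
  have "openin (top_of_set (\<phi> ` U)) (\<phi> ` (U \<inter> W))"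
    using homeomorphism_imp_open_map[OF manifold_chart_homeomorphism[OF assms(1,2)]]
      openin_open_Int[OF assms(3)] by blast
  then show ?thesis
    using manifold_chart_open_image[OF assms(1,2)] openin_open_trans by blast
qed

lemma smooth_manifold_transition:
  assumes "smooth_manifold A" "(U, \<phi>) \<in> A" "(V, \<psi>) \<in> A"
  shows "smooth_on (\<phi> ` (U \<inter> V)) (\<lambda>y. \<psi> (inv_into U \<phi> y))"
  using assms unfolding smooth_manifold_def comp_def by blast

lemma smooth_functionsD:
  "f \<in> smooth_functions A \<Longrightarrow> (U, \<phi>) \<in> A \<Longrightarrow> smooth_on (\<phi> ` U) (\<lambda>y. f (inv_into U \<phi> y))"
  unfolding smooth_functions_def comp_def by blast

lemma smooth_functionsI:
  "(\<And>U \<phi>. (U, \<phi>) \<in> A \<Longrightarrow> smooth_on (\<phi> ` U) (\<lambda>y. f (inv_into U \<phi> y))) \<Longrightarrow> f \<in> smooth_functions A"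
  unfolding smooth_functions_def comp_def by blast

lemma smooth_functions_const: "smooth_manifold A \<Longrightarrow> (\<lambda>q. c) \<in> smooth_functions A"
  by (rule smooth_functionsI, rule smooth_on_const, rule manifold_chart_open_image)

lemma smooth_functions_add:
  "smooth_manifold A \<Longrightarrow> f \<in> smooth_functions A \<Longrightarrow> h \<in> smooth_functions A
    \<Longrightarrow> f + h \<in> smooth_functions A"
  unfolding plus_fun_def
  by (rule smooth_functionsI, rule smooth_on_add) (assumption | rule manifold_chart_open_image smooth_functionsD)+

lemma smooth_functions_mult:
  "smooth_manifold A \<Longrightarrow> f \<in> smooth_functions A \<Longrightarrow> h \<in> smooth_functions A
    \<Longrightarrow> f * h \<in> smooth_functions A"
  unfolding times_fun_def
  by (rule smooth_functionsI, rule smooth_on_mult) (assumption | rule manifold_chart_open_image smooth_functionsD)+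

lemma smooth_functions_cmult:
  "smooth_manifold A \<Longrightarrow> f \<in> smooth_functions A \<Longrightarrow> (\<lambda>q. c * f q) \<in> smooth_functions A"
  using smooth_functions_mult[OF _ smooth_functions_const[of A c]] unfolding times_fun_def by blast

lemma smooth_functions_sum:
  assumes "smooth_manifold A" "\<And>i. i \<in> I \<Longrightarrow> f i \<in> smooth_functions A"
  shows "(\<lambda>q. \<Sum>i\<in>I. f i q) \<in> smooth_functions A"
  by (rule smooth_functionsI, rule smooth_on_sum)
    (assumption | rule manifold_chart_open_image[OF assms(1)] smooth_functionsD[OF assms(2)])+

text \<open>Two kinds of open sets cover the manifold: the preimage of \<open>N\<close>, where a
  transition map composed with \<open>h\<close> is smooth, and the complement of the copy of
  \<open>C\<close>, where the extension vanishes identically.\<close>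

lemma extend_by_zero_smooth:
  assumes M: "smooth_manifold A" and chart: "(U, \<phi>) \<in> A"
    and N: "open N" "N \<subseteq> \<phi> ` U" and C: "compact C" "C \<subseteq> N"
    and h: "smooth_on N h" and zero: "\<And>x. x \<in> \<phi> ` U - C \<Longrightarrow> h x = 0"
  shows "(\<lambda>q. if q \<in> U then h (\<phi> q) else 0) \<in> smooth_functions A" (is "?f \<in> _")
proof (rule smooth_functionsI)
  fix V \<psi> assume V: "(V, \<psi>) \<in> A"
  note homU = manifold_chart_homeomorphism[OF M chart]
  have "continuous_on C (inv_into U \<phi>)"
    by (rule continuous_on_subset[OF homeomorphism_cont2[OF homU] order_trans[OF C(2) N(2)]])
  \<comment> \<open>The Hausdorff property is used here: a compact set is closed in the whole
    manifold, not merely in \<open>U\<close>.\<close>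
  then have closed: "closed (inv_into U \<phi> ` C)"
    by (intro compact_imp_closed compact_continuous_image C(1))
  have W: "open (U \<inter> \<phi> -` N)"
    by (rule continuous_open_preimage[OF homeomorphism_cont1[OF homU] manifold_chart_open[OF M chart] N(1)])
  show "smooth_on (\<psi> ` V) (\<lambda>y. ?f (inv_into V \<psi> y))"
  proof (rule smooth_on_locally)
    fix y assume "y \<in> \<psi> ` V"
    then obtain q where q: "q \<in> V" "y = \<psi> q" by blast
    show "\<exists>O'. open O' \<and> y \<in> O' \<and> smooth_on O' (\<lambda>y. ?f (inv_into V \<psi> y))"
    proof (cases "q \<in> U \<inter> \<phi> -` N")
      case True
      let ?O = "\<psi> ` (V \<inter> (U \<inter> \<phi> -` N))"
      have opn: "open ?O" by (rule manifold_chart_open_map[OF M V W])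
      have inv: "inv_into V \<psi> z \<in> U \<inter> \<phi> -` N" if "z \<in> ?O" for z
      proof -
        obtain w where "w \<in> V" "w \<in> U \<inter> \<phi> -` N" "z = \<psi> w" using \<open>z \<in> ?O\<close> by blast
        then show ?thesis using manifold_chart_inverse[OF M V] by simp
      qed
      have "smooth_on ?O (\<lambda>y. h (\<phi> (inv_into V \<psi> y)))"
      proof (rule smooth_on_compose[OF opn N(1) _ h])
        show "smooth_on ?O (\<lambda>y. \<phi> (inv_into V \<psi> y))"
          by (rule smooth_on_subset[OF smooth_manifold_transition[OF M V chart]]) blast
      qed (use inv in blast)
      then have "smooth_on ?O (\<lambda>y. ?f (inv_into V \<psi> y))"
        by (rule smooth_on_cong[OF opn, rotated]) (use inv in \<open>simp only: Int_iff if_True\<close>)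
      then show ?thesis using opn True q by blast
    next
      case False
      let ?O = "\<psi> ` (V \<inter> - inv_into U \<phi> ` C)"
      have opn: "open ?O"
        by (rule manifold_chart_open_map[OF M V]) (use closed in auto)
      have "q \<notin> inv_into U \<phi> ` C"
      proof
        assume "q \<in> inv_into U \<phi> ` C"
        then obtain c where c: "c \<in> C" "q = inv_into U \<phi> c" by blast
        then have "q \<in> U" "\<phi> q = c"
          using N C by (auto simp: inv_into_into f_inv_into_f subset_iff)
        then show False using False c C by blast
      qed
      moreover have "?f (inv_into V \<psi> z) = 0" if "z \<in> ?O" for z
      proof -
        obtain w where w: "w \<in> V" "w \<notin> inv_into U \<phi> ` C" "inv_into V \<psi> z = w"
          using \<open>z \<in> ?O\<close> manifold_chart_inverse[OF M V] by blast
        have "\<phi> w \<notin> C" if "w \<in> U"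
        proof
          assume "\<phi> w \<in> C"
          then have "inv_into U \<phi> (\<phi> w) \<in> inv_into U \<phi> ` C" by blast
          then show False using w(2) manifold_chart_inverse[OF M chart that] by simp
        qed
        then show ?thesis using zero w(3) by simp
      qed
      moreover from this have "smooth_on ?O (\<lambda>y. ?f (inv_into V \<psi> y))"
        by (intro smooth_on_cong[OF opn _ smooth_on_const[OF opn, of 0]]) (rule sym)
      ultimately show ?thesis using opn q by blast
    qed
  qed
qed

section \<open>Derivations at a point and their extension\<close>

lemma
  assumes "v \<in> tangent_space A p"
  shows tangent_space_add: "f \<in> smooth_functions A \<Longrightarrow> h \<in> smooth_functions A \<Longrightarrow> v (f + h) = v f + v h"
    and tangent_space_cmult: "f \<in> smooth_functions A \<Longrightarrow> v (\<lambda>q. c * f q) = c * v f"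
    and tangent_space_mult: "f \<in> smooth_functions A \<Longrightarrow> h \<in> smooth_functions A
      \<Longrightarrow> v (f * h) = f p * v h + h p * v f"
    and tangent_space_undefined: "f \<notin> smooth_functions A \<Longrightarrow> v f = 0"
  using assms unfolding tangent_space_def by blast+

lemma tangent_space_sum:
  assumes M: "smooth_manifold A" and v: "v \<in> tangent_space A p"
    and f: "\<And>i. i \<in> I \<Longrightarrow> f i \<in> smooth_functions A"
  shows "v (\<lambda>q. \<Sum>i\<in>I. f i q) = (\<Sum>i\<in>I. v (f i))"
proof -
  have v0: "v (\<lambda>q. 0) = 0"
    using tangent_space_cmult[OF v smooth_functions_const[OF M, of 0], of 0] by simp
  show ?thesis using f
  proof (induction I rule: infinite_finite_induct)
    case (insert i I)
    have "(\<lambda>q. \<Sum>i\<in>insert i I. f i q) = f i + (\<lambda>q. \<Sum>i\<in>I. f i q)"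
      using insert.hyps by (auto simp: fun_eq_iff)
    then show ?case
      using tangent_space_add[OF v insert.prems smooth_functions_sum[OF M insert.prems], of i I] insert
      by simp
  qed (simp_all add: v0)
qed

text \<open>In chart coordinates \<open>v\<close> is the sum of v(x_b) times the partial derivative
  in direction b. A bump times the field with these constant coefficients extends it. As derivations
  act on global functions only, the coordinates too must first be cut off by the bump.\<close>

lemma tangent_vector_extends:
  fixes A :: "('a::{t2_space, second_countable_topology}, 'e::euclidean_space) atlas"
  assumes M: "smooth_manifold A" and v: "v \<in> tangent_space A p"
  obtains Y where "Y \<in> vector_fields A" "Y p = v"
proof -
  let ?S = "smooth_functions A"
  obtain U \<phi> where chart: "(U, \<phi>) \<in> A" and p: "p \<in> U"
    using M unfolding smooth_manifold_def by blast
  let ?inv = "inv_into U \<phi>"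
  define a where "a = \<phi> p"
  note opn = manifold_chart_open_image[OF M chart] and inv = manifold_chart_inverse[OF M chart]
  have "a \<in> \<phi> ` U" using p a_def by simp
  then obtain R where R: "R > 0" "ball a R \<subseteq> \<phi> ` U"
    using opn open_contains_ball by blast
  define r where "r = R / 2"
  have r: "r > 0" "cball a r \<subseteq> ball a R" using R by (auto simp: r_def)
  have rU: "cball a r \<subseteq> \<phi> ` U" using r R by blast
  obtain \<beta> :: "'e \<Rightarrow> real" where \<beta>: "smooth_on UNIV \<beta>" "\<beta> a = 1" "\<And>x. x \<notin> cball a r \<Longrightarrow> \<beta> x = 0"
    using bump_function[OF r(1)] by blast
  \<comment> \<open>This pulls a function of the coordinates back to the manifold, cut off by
    \<beta>; it is the only source of global smooth functions built from the chart.\<close>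
  define ext where "ext h = (\<lambda>q. if q \<in> U then \<beta> (\<phi> q) * h (\<phi> q) else 0)" for h
  have ext: "ext h \<in> ?S" if h: "smooth_on N h" and N: "open N" "cball a r \<subseteq> N" "N \<subseteq> \<phi> ` U" for h N
    unfolding ext_def
  proof (rule extend_by_zero_smooth[OF M chart N(1,3) compact_cball N(2)])
    show "smooth_on N (\<lambda>x. \<beta> x * h x)"
      by (intro smooth_on_mult N h smooth_on_subset[OF \<beta>(1)]) simp
  qed (use \<beta>(3) in auto)
  \<comment> \<open>These are the coordinates centred at \<open>p\<close>, cut off; they vanish at
    \<open>p\<close>.\<close>
  define x where "x b = ext (\<lambda>x. (x - a) \<bullet> b)" for b
  have lin: "smooth_on (\<phi> ` U) (\<lambda>x. (x - a) \<bullet> b)" for b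
    using smooth_on_add[OF opn smooth_on_bounded_linear[OF opn bounded_linear_inner_left]
        smooth_on_const[OF opn], of b "- (a \<bullet> b)"] by (simp add: inner_diff_left)
  have x: "x b \<in> ?S" for b
    unfolding x_def using ext[OF lin opn rU order_refl] .
  define d where "d f q b = frechet_derivative (\<lambda>y. f (?inv y)) (at (\<phi> q)) b"
    for f :: "'a \<Rightarrow> real" and q b
  have hd: "((\<lambda>y. f (?inv y)) has_derivative d f q) (at (\<phi> q))" if "f \<in> ?S" "q \<in> U" for f q
    unfolding d_def using smooth_on_has_derivative[OF smooth_functionsD[OF that(1) chart]] that by blast
  have d_add: "d (f + h) q b = d f q b + d h q b" if "f \<in> ?S" "h \<in> ?S" "q \<in> U" for f h q b
  proof -
    have "((\<lambda>y. (f + h) (?inv y)) has_derivative (\<lambda>b. d f q b + d h q b)) (at (\<phi> q))"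
      unfolding plus_fun_def by (intro has_derivative_add hd that)
    from has_derivative_unique[OF hd this] show ?thesis
      using smooth_functions_add[OF M that(1,2)] that(3) by metis
  qed
  have d_cmult: "d (\<lambda>q. c * f q) q b = c * d f q b" if "f \<in> ?S" "q \<in> U" for c f q b
  proof -
    have "((\<lambda>y. c * f (?inv y)) has_derivative (\<lambda>b. c * d f q b)) (at (\<phi> q))"
      by (intro has_derivative_mult_right hd that)
    from has_derivative_unique[OF hd this] show ?thesis
      using smooth_functions_cmult[OF M that(1)] that(2) by metis
  qed
  have d_mult: "d (f * h) q b = f q * d h q b + h q * d f q b"
    if "f \<in> ?S" "h \<in> ?S" "q \<in> U" for f h q b
  proof -
    have "((\<lambda>y. (f * h) (?inv y)) has_derivative
        (\<lambda>b. f (?inv (\<phi> q)) * d h q b + d f q b * h (?inv (\<phi> q)))) (at (\<phi> q))"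
      unfolding times_fun_def by (intro has_derivative_mult hd that)
    from has_derivative_unique[OF hd this] have
      "d (f * h) q = (\<lambda>b. f (?inv (\<phi> q)) * d h q b + d f q b * h (?inv (\<phi> q)))"
      using smooth_functions_mult[OF M that(1,2)] that(3) by blast
    then show ?thesis using inv[OF that(3)] by simp
  qed
  have v_eq: "v f = (\<Sum>b\<in>Basis. v (x b) * d f p b)" if f: "f \<in> ?S" for f
  proof -
    obtain h where h: "\<And>b. smooth_on (ball a R) (h b)"
      "\<And>b. h b a = frechet_derivative (\<lambda>y. f (?inv y)) (at a) b"
      "\<And>x. x \<in> ball a R \<Longrightarrow> f (?inv x) = f (?inv a) + (\<Sum>b\<in>Basis. ((x - a) \<bullet> b) * h b x)"
      using Hadamard[OF smooth_on_subset[OF smooth_functionsD[OF f chart] R(2)]] by metis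
    define k where "k b = ext (h b)" for b
    have k: "k b \<in> ?S" for b
      unfolding k_def by (rule ext[OF h(1) open_ball r(2) R(2)])
    \<comment> \<open>Multiplying Hadamard's expansion of f by the square of the bump turns each factor into
      a global smooth function, to which the derivation v applies.\<close>
    define \<eta> where "\<eta> = ext (\<lambda>_. 1) * ext (\<lambda>_. 1)"
    have \<eta>: "\<eta> \<in> ?S"
      unfolding \<eta>_def by (intro smooth_functions_mult[OF M] ext[OF smooth_on_const[OF opn] opn rU order_refl])
    have "(\<eta> * f) q = ((\<lambda>q. f p * \<eta> q) + (\<lambda>q. \<Sum>b\<in>Basis. (x b * k b) q)) q" for q
    proof (cases "q \<in> U \<and> \<phi> q \<in> cball a r")
      case True
      then have "f q = f p + (\<Sum>b\<in>Basis. ((\<phi> q - a) \<bullet> b) * h b (\<phi> q))"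
        using h(3)[of "\<phi> q"] r(2) inv[of q] inv[OF p] by (auto simp: a_def)
      then show ?thesis
        using True by (simp add: \<eta>_def x_def k_def ext_def sum_distrib_left algebra_simps)
    next
      case False
      then have "ext h q = 0" for h using \<beta>(3) by (auto simp: ext_def)
      then show ?thesis by (simp add: \<eta>_def x_def k_def)
    qed
    then have "v (\<eta> * f) = v ((\<lambda>q. f p * \<eta> q) + (\<lambda>q. \<Sum>b\<in>Basis. (x b * k b) q))"
      by presburger
    also have "\<dots> = f p * v \<eta> + (\<Sum>b\<in>Basis. v (x b * k b))"
      by (simp only: tangent_space_add[OF v smooth_functions_cmult[OF M \<eta>]
            smooth_functions_sum[OF M smooth_functions_mult[OF M x k]]]
          tangent_space_cmult[OF v \<eta>] tangent_space_sum[OF M v smooth_functions_mult[OF M x k]])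
    \<comment> \<open>Since \<open>x b\<close> vanishes at \<open>p\<close>, the product rule leaves
      only \<open>k b p * v (x b)\<close>, and \<open>k b p\<close> is the partial derivative of
      \<open>f\<close>.\<close>
    also have "(\<Sum>b\<in>Basis. v (x b * k b)) = (\<Sum>b\<in>Basis. v (x b) * d f p b)"
    proof (rule sum.cong[OF refl])
      fix b
      have "x b p = 0" "k b p = d f p b"
        using p h(2)[of b] \<beta>(2) by (simp_all add: x_def k_def ext_def d_def a_def)
      then show "v (x b * k b) = v (x b) * d f p b"
        using tangent_space_mult[OF v x k] by simp
    qed
    \<comment> \<open>Both expansions contain \<open>f p * v \<eta>\<close>, which cancels; \<eta>
      equals 1 at \<open>p\<close>, so \<open>v f\<close> remains.\<close>
    also have "v (\<eta> * f) = \<eta> p * v f + f p * v \<eta>"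
      by (rule tangent_space_mult[OF v \<eta> f])
    also have "\<eta> p = 1"
      using p \<beta>(2) by (simp add: \<eta>_def ext_def a_def)
    finally show ?thesis by simp
  qed
  \<comment> \<open>The guard \<open>f \<in> ?S\<close> supplies the default 0 that
    \<open>tangent_space\<close> prescribes off the smooth functions; the bump makes extension by 0
    outside \<open>U\<close> smooth.\<close>
  define Y where "Y q f = (if f \<in> ?S \<and> q \<in> U then \<beta> (\<phi> q) * (\<Sum>b\<in>Basis. v (x b) * d f q b) else 0)"
    for q f
  have "Y q \<in> tangent_space A q" for q
  proof (cases "q \<in> U")
    case True
    show ?thesis
      unfolding tangent_space_def mem_Collect_eq
      by (intro conjI ballI allI impI)
        (simp_all add: Y_def True smooth_functions_add[OF M] smooth_functions_cmult[OF M]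
          smooth_functions_mult[OF M] d_add d_cmult d_mult sum_distrib_left sum.distrib algebra_simps)
  next
    case False
    then show ?thesis unfolding tangent_space_def by (simp add: Y_def)
  qed
  moreover have "apply_vfield Y f \<in> ?S" if f: "f \<in> ?S" for f
  proof -
    let ?h = "\<lambda>y. \<Sum>b\<in>Basis. v (x b) * frechet_derivative (\<lambda>y. f (?inv y)) (at y) b"
    have "smooth_on (\<phi> ` U) ?h"
      by (intro smooth_on_sum smooth_on_mult smooth_on_const opn
          smooth_on_frechet_derivative smooth_functionsD[OF f chart])
    from ext[OF this opn rU order_refl] have "ext ?h \<in> ?S" .
    also have "ext ?h = apply_vfield Y f"
      using f by (simp add: ext_def apply_vfield_def Y_def d_def fun_eq_iff)
    finally show ?thesis .
  qed
  ultimately have "Y \<in> vector_fields A" unfolding vector_fields_def by blast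
  moreover have "Y p f = v f" for f
    using v_eq[of f] tangent_space_undefined[OF v, of f] p \<beta>(2)[unfolded a_def] by (simp add: Y_def)
  ultimately show ?thesis using that by blast
qed

text \<open>Nondegeneracy is assumed pointwise against all tangent vectors, while the identities
  below only test against vector fields; extending each tangent vector closes this gap.\<close>

lemma pseudo_riemannian_metric_nondegenerate:
  fixes A :: "('a::{t2_space, second_countable_topology}, 'e::euclidean_space) atlas"
  assumes M: "smooth_manifold A" and g: "pseudo_riemannian_metric A g"
    and X: "X \<in> vector_fields A" and zero: "\<And>Y. Y \<in> vector_fields A \<Longrightarrow> form_apply g X Y = 0"
  shows "X = 0"
proof
  fix p
  have Xp: "X p \<in> tangent_space A p" using X by (simp add: vector_fields_def)
  have "g p (X p) w = 0" if w: "w \<in> tangent_space A p" for w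
  proof -
    obtain Y where "Y \<in> vector_fields A" "Y p = w" using tangent_vector_extends[OF M w] .
    then show ?thesis using fun_cong[OF zero, of Y p] by (simp add: form_apply_def)
  qed
  then have "X p = 0" using g Xp unfolding pseudo_riemannian_metric_def by blast
  then show "X p = 0 p" by simp
qed

section \<open>The Levi-Civita connections of a Norden metric and its associated metric\<close>

lemma tangent_space_closed_add:
  "u \<in> tangent_space A p \<Longrightarrow> v \<in> tangent_space A p \<Longrightarrow> u + v \<in> tangent_space A p"
  unfolding tangent_space_def by (simp add: algebra_simps)

lemma tangent_space_closed_uminus: "u \<in> tangent_space A p \<Longrightarrow> - u \<in> tangent_space A p"
  unfolding tangent_space_def by (simp add: algebra_simps)

lemma vector_fields_tangent: "X \<in> vector_fields A \<Longrightarrow> X p \<in> tangent_space A p"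
  unfolding vector_fields_def by simp

lemma vector_fields_add:
  assumes "smooth_manifold A" "X \<in> vector_fields A" "Y \<in> vector_fields A"
  shows "X + Y \<in> vector_fields A"
proof -
  have "apply_vfield (X + Y) f = apply_vfield X f + apply_vfield Y f" for f
    by (auto simp: apply_vfield_def)
  then show ?thesis
    using assms smooth_functions_add[OF assms(1)] unfolding vector_fields_def
    by (simp add: tangent_space_closed_add)
qed

lemma vector_fields_uminus:
  assumes "smooth_manifold A" "X \<in> vector_fields A"
  shows "- X \<in> vector_fields A"
proof -
  have "apply_vfield (- X) f = (\<lambda>p. - 1 * apply_vfield X f p)" for f
    by (auto simp: apply_vfield_def)
  then show ?thesis
    using assms smooth_functions_cmult[OF assms(1), of _ "- 1"] unfolding vector_fields_def
    by (simp add: tangent_space_closed_uminus)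
qed

lemma vector_fields_diff:
  assumes "smooth_manifold A" "X \<in> vector_fields A" "Y \<in> vector_fields A"
  shows "X - Y \<in> vector_fields A"
  using vector_fields_add[OF assms(1,2) vector_fields_uminus[OF assms(1,3)]] by simp

text \<open>Apply additivity to (X - Y) + Y. A general \<open>L\<close>, additive on vector fields
  only, lets this lemma and the next serve \<open>J\<close>, the metric, the connection and the
  tensor T alike.\<close>

lemma additive_on_vector_fields_diff:
  fixes L :: "'a::{t2_space, second_countable_topology} vfield \<Rightarrow> 'b::ab_group_add"
  assumes "smooth_manifold A"
    and "\<And>X Y. X \<in> vector_fields A \<Longrightarrow> Y \<in> vector_fields A \<Longrightarrow> L (X + Y) = L X + L Y"
    and "X \<in> vector_fields A" "Y \<in> vector_fields A"
  shows "L (X - Y) = L X - L Y"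
  using assms(2)[OF vector_fields_diff[OF assms(1,3,4)] assms(4)] by (simp add: algebra_simps)

lemma additive_on_vector_fields_uminus:
  fixes L :: "'a::{t2_space, second_countable_topology} vfield \<Rightarrow> 'b::ab_group_add"
  assumes "smooth_manifold A"
    and "\<And>X Y. X \<in> vector_fields A \<Longrightarrow> Y \<in> vector_fields A \<Longrightarrow> L (X + Y) = L X + L Y"
    and "X \<in> vector_fields A"
  shows "L (- X) = - L X"
proof -
  have zero: "0 \<in> vector_fields A"
    using vector_fields_diff[OF assms(1,3,3)] by simp
  have "L 0 = 0" using assms(2)[OF zero zero] by simp
  then show ?thesis
    using additive_on_vector_fields_diff[where L = L, OF assms(1,2) zero assms(3)] by simp
qed

section \<open>The difference tensor of the two Levi-Civita connections\<close>

text \<open>It is stated for an arbitrary Norden metric so that it applies twice: to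
  \<open>g\<close>, and to its associated metric with the two connections exchanged.\<close>

lemma levi_civita_difference:
  fixes A :: "('a::{t2_space, second_countable_topology}, 'e::euclidean_space) atlas"
  assumes qk: "quasi_kaehler_norden A J g"
    and LC: "levi_civita A g D" and LC': "levi_civita A (associated_metric J g) D'"
    and X: "X \<in> vector_fields A" and Y: "Y \<in> vector_fields A"
  shows "D' X Y = D X Y + T_tensor D J X Y"
proof -
  let ?V = "vector_fields A"
  have "almost_complex_norden A J g" using qk by (simp add: quasi_kaehler_norden_def)
  then have M: "smooth_manifold A" and g: "pseudo_riemannian_metric A g" and J: "tensor_1_1 A J"
    and JJ: "\<And>X. X \<in> ?V \<Longrightarrow> J \<bullet>\<^sub>e (J \<bullet>\<^sub>e X) = - X"
    and norden: "\<And>X Y. X \<in> ?V \<Longrightarrow> Y \<in> ?V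
      \<Longrightarrow> form_apply g (J \<bullet>\<^sub>e X) (J \<bullet>\<^sub>e Y) = - form_apply g X Y"
    unfolding almost_complex_norden_def by simp_all
  have JV: "J \<bullet>\<^sub>e X \<in> ?V" if "X \<in> ?V" for X
    using J that unfolding tensor_1_1_def by blast
  have J_add: "J \<bullet>\<^sub>e (X + Y) = J \<bullet>\<^sub>e X + J \<bullet>\<^sub>e Y" if "X \<in> ?V" "Y \<in> ?V" for X Y
    using J that[THEN vector_fields_tangent] unfolding tensor_1_1_def endo_apply_def
    by (simp add: fun_eq_iff)
  have J_diff: "J \<bullet>\<^sub>e (X - Y) = J \<bullet>\<^sub>e X - J \<bullet>\<^sub>e Y" if "X \<in> ?V" "Y \<in> ?V" for X Y
    by (rule additive_on_vector_fields_diff[where L = "endo_apply J", OF M J_add that])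
  define G where "G = form_apply g"
  have G_sym: "G X Y = G Y X" if "X \<in> ?V" "Y \<in> ?V" for X Y
  proof
    fix p
    show "G X Y p = G Y X p"
      using g vector_fields_tangent[OF that(1), of p] vector_fields_tangent[OF that(2), of p]
      unfolding pseudo_riemannian_metric_def G_def form_apply_def by simp
  qed
  have G_add: "G (X + Y) Z = G X Z + G Y Z" if "X \<in> ?V" "Y \<in> ?V" "Z \<in> ?V" for X Y Z
    using g that[THEN vector_fields_tangent]
    unfolding pseudo_riemannian_metric_def tensor_0_2_def G_def form_apply_def
    by (simp add: fun_eq_iff)
  have G_diff: "G (X - Y) Z = G X Z - G Y Z" if "X \<in> ?V" "Y \<in> ?V" "Z \<in> ?V" for X Y Z
    by (rule additive_on_vector_fields_diff[where L = "\<lambda>X. G X Z", OF M _ that(1,2)])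
      (rule G_add[OF _ _ that(3)])
  have G_uminus: "G (- X) Z = - G X Z" if "X \<in> ?V" "Z \<in> ?V" for X Z
    by (rule additive_on_vector_fields_uminus[where L = "\<lambda>X. G X Z", OF M _ that(1)])
      (rule G_add[OF _ _ that(2)])
  \<comment> \<open>\<open>J\<close> is self-adjoint for \<open>g\<close>: apply the Norden
    condition to JX and Y and use J^2 = -1.\<close>
  have GJ: "G (J \<bullet>\<^sub>e X) Y = G X (J \<bullet>\<^sub>e Y)" if X: "X \<in> ?V" and Y: "Y \<in> ?V" for X Y
  proof -
    have "G (J \<bullet>\<^sub>e (J \<bullet>\<^sub>e X)) (J \<bullet>\<^sub>e Y) = - G (J \<bullet>\<^sub>e X) Y"
      unfolding G_def by (rule norden[OF JV[OF X] Y])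
    then show ?thesis using JJ[OF X] G_uminus[OF X JV[OF Y]] by simp
  qed
  have DV: "D X Y \<in> ?V" "D' X Y \<in> ?V" if "X \<in> ?V" "Y \<in> ?V" for X Y
    using LC LC' that by (simp_all add: levi_civita_def affine_connection_def)
  have D_add: "D Z (X + Y) = D Z X + D Z Y" if "X \<in> ?V" "Y \<in> ?V" "Z \<in> ?V" for X Y Z
    using LC that by (simp add: levi_civita_def affine_connection_def)
  have D_uminus: "D Z (- X) = - D Z X" if "Z \<in> ?V" "X \<in> ?V" for X Z
    by (rule additive_on_vector_fields_uminus[where L = "D Z", OF M _ that(2)])
      (rule D_add[OF _ _ that(1)])
  define N where "N = nabla_J D J"
  have N: "D X (J \<bullet>\<^sub>e Y) = N X Y + J \<bullet>\<^sub>e D X Y" for X Y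
    by (simp add: N_def nabla_J_def)
  have NV: "N X Y \<in> ?V" if "X \<in> ?V" "Y \<in> ?V" for X Y
    unfolding N_def nabla_J_def by (intro vector_fields_diff[OF M] DV JV that)
  define \<Phi> where "\<Phi> X Y = D' X Y - D X Y" for X Y
  have \<Phi>V: "\<Phi> X Y \<in> ?V" if "X \<in> ?V" "Y \<in> ?V" for X Y
    unfolding \<Phi>_def by (intro vector_fields_diff[OF M] DV that)
  have \<Phi>_sym: "\<Phi> X Y = \<Phi> Y X" if "X \<in> ?V" "Y \<in> ?V" for X Y
  proof -
    have "D X Y - D Y X = lie_bracket X Y" "D' X Y - D' Y X = lie_bracket X Y"
      using LC LC' that by (simp_all add: levi_civita_def)
    then show ?thesis unfolding \<Phi>_def by (simp add: algebra_simps)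
  qed
  \<comment> \<open>By self-adjointness this is \<Phi> with its value lowered by the associated
    metric. It is symmetric in \<open>X\<close> and \<open>Y\<close> because \<Phi> is.\<close>
  define B where "B X Y Z = G (J \<bullet>\<^sub>e \<Phi> X Y) Z" for X Y Z
  \<comment> \<open>Differentiate g(Y, JZ) along \<open>X\<close> twice: as the associated metric of
    Y and Z using \<open>D'\<close>, and as \<open>g\<close> of Y and JZ using \<open>D\<close>. The
    difference leaves only the derivative of \<open>J\<close>.\<close>
  have B_eq: "B X Y Z + B X Z Y = G (N X Z) Y" if X: "X \<in> ?V" and Y: "Y \<in> ?V" and Z: "Z \<in> ?V" for X Y Z
  proof -
    have g': "form_apply (associated_metric J g) Y Z = G Y (J \<bullet>\<^sub>e Z)" for Y Z
      unfolding form_apply_def associated_metric_def G_def endo_apply_def ..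
    have "G (D' X Y) (J \<bullet>\<^sub>e Z) + G Y (J \<bullet>\<^sub>e D' X Z) = apply_vfield X (G Y (J \<bullet>\<^sub>e Z))"
      using LC' X Y Z by (simp add: levi_civita_def g')
    also have "\<dots> = G (D X Y) (J \<bullet>\<^sub>e Z) + G Y (D X (J \<bullet>\<^sub>e Z))"
      using LC X Y JV[OF Z] by (simp add: levi_civita_def G_def)
    also have "G Y (D X (J \<bullet>\<^sub>e Z)) = G (N X Z) Y + G (J \<bullet>\<^sub>e D X Z) Y"
      unfolding N using G_sym[OF Y] G_add[OF _ _ Y]
      by (metis DV(1) JV NV X Z vector_fields_add[OF M])
    finally have "G (J \<bullet>\<^sub>e D' X Y) Z + G (J \<bullet>\<^sub>e D' X Z) Y
        = G (J \<bullet>\<^sub>e D X Y) Z + (G (N X Z) Y + G (J \<bullet>\<^sub>e D X Z) Y)"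
      by (simp only: GJ[OF DV(1)[OF X Y] Z] GJ[OF DV(2)[OF X Y] Z] G_sym[OF Y JV[OF DV(2)[OF X Z]]])
    then show ?thesis
      unfolding B_def \<Phi>_def
      by (simp add: J_diff G_diff DV JV X Y Z algebra_simps)
  qed
  have "J \<bullet>\<^sub>e \<Phi> X Y - (N X Y + N Y X) = 0"
  proof (rule pseudo_riemannian_metric_nondegenerate[OF M g])
    show "J \<bullet>\<^sub>e \<Phi> X Y - (N X Y + N Y X) \<in> ?V"
      by (intro vector_fields_diff[OF M] vector_fields_add[OF M] JV \<Phi>V NV X Y)
    fix Z assume Z: "Z \<in> ?V"
    have cyc: "G (N X Y) Z + G (N Y Z) X + G (N Z X) Y = 0"
      using qk LC X Y Z by (simp add: quasi_kaehler_norden_def F_tensor_def G_def N_def)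
    \<comment> \<open>The Koszul combination gives 2 B(X,Y,Z) = F(X,Y,Z) + F(Y,X,Z) - F(Z,X,Y), and
      the cyclic sum replaces the last term. Using \<open>B_eq\<close> in both orders of the last
      two arguments also supplies the symmetry of F in them.\<close>
    have "B X Y Z = G (N X Y) Z + G (N Y X) Z"
    proof
      fix p
      have "B Y X Z = B X Y Z" "B Z X Y = B X Z Y" "B Z Y X = B Y Z X"
        unfolding B_def using \<Phi>_sym X Y Z by simp_all
      with fun_cong[OF B_eq[OF X Y Z], of p] fun_cong[OF B_eq[OF X Z Y], of p]
        fun_cong[OF B_eq[OF Y X Z], of p] fun_cong[OF B_eq[OF Y Z X], of p]
        fun_cong[OF B_eq[OF Z X Y], of p] fun_cong[OF B_eq[OF Z Y X], of p] fun_cong[OF cyc, of p]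
      show "B X Y Z p = (G (N X Y) Z + G (N Y X) Z) p"
        by simp
    qed
    then show "form_apply g (J \<bullet>\<^sub>e \<Phi> X Y - (N X Y + N Y X)) Z = 0"
      unfolding G_def[symmetric] B_def
      by (simp add: G_diff G_add vector_fields_add[OF M] JV \<Phi>V NV X Y Z)
  qed
  then have J\<Phi>: "J \<bullet>\<^sub>e \<Phi> X Y = N X Y + N Y X" by simp
  \<comment> \<open>Differentiating J^2 = -1 shows that \<open>J\<close> anticommutes with its
    covariant derivative.\<close>
  have NJ: "N X (J \<bullet>\<^sub>e Y) = - (J \<bullet>\<^sub>e N X Y)" if X: "X \<in> ?V" and Y: "Y \<in> ?V" for X Y
    using J_diff[OF DV(1)[OF X JV[OF Y]] JV[OF DV(1)[OF X Y]]] JJ[OF Y] JJ[OF DV(1)[OF X Y]]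
      D_uminus[OF X Y] by (simp add: N_def nabla_J_def)
  have "T_tensor D J X Y = - (J \<bullet>\<^sub>e N X Y + J \<bullet>\<^sub>e N Y X)"
    using NJ[OF X Y] NJ[OF Y X] by (simp add: T_tensor_def N_def)
  also have "\<dots> = - (J \<bullet>\<^sub>e (J \<bullet>\<^sub>e \<Phi> X Y))"
    unfolding J\<Phi> using J_add[OF NV[OF X Y] NV[OF Y X]] by simp
  also have "\<dots> = \<Phi> X Y" using JJ[OF \<Phi>V[OF X Y]] by simp
  finally show ?thesis by (simp add: \<Phi>_def)
qed

text \<open>As J^2 = -1, passing to the associated metric twice gives -g on vector fields; the sign
  affects neither the torsion nor metric compatibility.\<close>

lemma levi_civita_associated_twice:
  fixes A :: "('a::{t2_space, second_countable_topology}, 'e::euclidean_space) atlas"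
  assumes norden: "almost_complex_norden A J g" and LC: "levi_civita A g D"
  shows "levi_civita A (associated_metric J (associated_metric J g)) D"
proof -
  let ?V = "vector_fields A" and ?g = "associated_metric J (associated_metric J g)"
  have M: "smooth_manifold A" and g: "tensor_0_2 A g"
    using norden unfolding almost_complex_norden_def pseudo_riemannian_metric_def by simp_all
  have DV: "D X Y \<in> ?V" if "X \<in> ?V" "Y \<in> ?V" for X Y
    using LC that unfolding levi_civita_def affine_connection_def by blast
  have g_eq: "form_apply ?g X Y = - form_apply g X Y" if X: "X \<in> ?V" and Y: "Y \<in> ?V" for X Y
  proof -
    have "form_apply ?g X Y = form_apply g X (J \<bullet>\<^sub>e (J \<bullet>\<^sub>e Y))"
      by (simp add: form_apply_def associated_metric_def endo_apply_def)
    also have "J \<bullet>\<^sub>e (J \<bullet>\<^sub>e Y) = - Y"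
      using norden Y unfolding almost_complex_norden_def by blast
    also have "form_apply g X (- Y) = - form_apply g X Y"
    proof (rule additive_on_vector_fields_uminus[OF M _ Y])
      fix Y Z assume "Y \<in> ?V" "Z \<in> ?V"
      then show "form_apply g X (Y + Z) = form_apply g X Y + form_apply g X Z"
        using g X[THEN vector_fields_tangent] unfolding tensor_0_2_def form_apply_def
        by (simp add: fun_eq_iff vector_fields_tangent)
    qed
    finally show ?thesis .
  qed
  have "apply_vfield X (form_apply ?g Y Z) = form_apply ?g (D X Y) Z + form_apply ?g Y (D X Z)"
    if X: "X \<in> ?V" and Y: "Y \<in> ?V" and Z: "Z \<in> ?V" for X Y Z
  proof -
    have "form_apply g Y Z \<in> smooth_functions A"
      using g Y Z unfolding tensor_0_2_def by blast
    \<comment> \<open>A derivation is linear on smooth functions only, so its value on the negated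
      function comes from homogeneity with factor -1, given smoothness.\<close>
    then have "X p (- form_apply g Y Z) = - X p (form_apply g Y Z)" for p
      using tangent_space_cmult[OF vector_fields_tangent[OF X], of "form_apply g Y Z" p "- 1"]
      by (simp add: fun_Compl_def)
    then have "apply_vfield X (- form_apply g Y Z) = - apply_vfield X (form_apply g Y Z)"
      by (auto simp: apply_vfield_def)
    then show ?thesis
      using LC X Y Z unfolding levi_civita_def by (simp add: g_eq DV)
  qed
  then show ?thesis using LC unfolding levi_civita_def by blast
qed

section \<open>Curvature under a change of connection by T\<close>

text \<open>Substitute \<open>D'\<close> = \<open>D\<close> + T in each term. Since \<open>D\<close>
  is torsion-free, the bracket is \<open>D X Y - D Y X\<close>, and T of the bracket provides
  exactly the first-slot corrections occurring in \<open>nabla_T\<close>.\<close>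

lemma curvature_difference:
  fixes A :: "('a::{t2_space, second_countable_topology}, 'e::euclidean_space) atlas"
  assumes M: "smooth_manifold A"
    and D: "affine_connection A D" and D': "affine_connection A D'"
    and torsion: "\<And>X Y. X \<in> vector_fields A \<Longrightarrow> Y \<in> vector_fields A \<Longrightarrow> D X Y - D Y X = lie_bracket X Y"
    and diff: "\<And>X Y. X \<in> vector_fields A \<Longrightarrow> Y \<in> vector_fields A \<Longrightarrow> D' X Y = D X Y + T_tensor D J X Y"
    and X: "X \<in> vector_fields A" and Y: "Y \<in> vector_fields A" and Z: "Z \<in> vector_fields A"
  shows "curvature D' X Y Z = curvature D X Y Z + Q_tensor D J X Y Z"
proof -
  let ?V = "vector_fields A"
  define T where "T = T_tensor D J"
  have DV: "D X Y \<in> ?V" "D' X Y \<in> ?V" if "X \<in> ?V" "Y \<in> ?V" for X Y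
    using D D' that unfolding affine_connection_def by blast+
  have add: "D Z (X + Y) = D Z X + D Z Y" "D' (X + Y) Z = D' X Z + D' Y Z" "D (X + Y) Z = D X Z + D Y Z"
    "D' Z (X + Y) = D' Z X + D' Z Y"
    if "X \<in> ?V" "Y \<in> ?V" "Z \<in> ?V" for X Y Z
    using D D' that unfolding affine_connection_def by blast+
  \<comment> \<open>Additivity of T is read off from T as a difference of connections rather than
    from its formula in \<open>J\<close>.\<close>
  have T: "T X Y = D' X Y - D X Y" if "X \<in> ?V" "Y \<in> ?V" for X Y
    unfolding T_def using diff[OF that] by simp
  have TV: "T X Y \<in> ?V" if "X \<in> ?V" "Y \<in> ?V" for X Y
    using T[OF that] vector_fields_diff[OF M DV(2,1)[OF that]] by simp
  have T_add_left: "T (X + Y) Z = T X Z + T Y Z" and T_add_right: "T Z (X + Y) = T Z X + T Z Y"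
    if "X \<in> ?V" "Y \<in> ?V" "Z \<in> ?V" for X Y Z
    using that by (simp_all add: T vector_fields_add[OF M] add)
  have T_diff: "T (X - Y) Z = T X Z - T Y Z" if "Z \<in> ?V" "X \<in> ?V" "Y \<in> ?V" for X Y Z
    by (rule additive_on_vector_fields_diff[where L = "\<lambda>X. T X Z", OF M _ that(2,3)])
      (rule T_add_left[OF _ _ that(1)])
  have DD: "D' X (D' Y Z) = D X (D Y Z) + D X (T Y Z) + (T X (D Y Z) + T X (T Y Z))"
    if X: "X \<in> ?V" and Y: "Y \<in> ?V" for X Y
  proof -
    have "D' X (D' Y Z) = D X (D Y Z + T Y Z) + T X (D Y Z + T Y Z)"
      using diff X Y Z DV TV vector_fields_add[OF M] unfolding T_def by simp
    then show ?thesis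
      using add(1)[OF DV(1)[OF Y Z] TV[OF Y Z] X] T_add_right[OF DV(1)[OF Y Z] TV[OF Y Z] X] by simp
  qed
  have bracket: "lie_bracket X Y = D X Y - D Y X" "lie_bracket X Y \<in> ?V"
    using torsion[OF X Y] vector_fields_diff[OF M DV(1)[OF X Y] DV(1)[OF Y X]] by simp_all
  have "D' (lie_bracket X Y) Z = D (lie_bracket X Y) Z + (T (D X Y) Z - T (D Y X) Z)"
    using diff[OF bracket(2) Z] T_diff[OF Z DV(1)[OF X Y] DV(1)[OF Y X]] unfolding bracket(1) T_def by simp
  then show ?thesis
    using DD[OF X Y] DD[OF Y X]
    unfolding curvature_def Q_tensor_def nabla_T_def T_def[symmetric] by (simp add: algebra_simps)
qed

section \<open>Invariance of \<open>S_connection\<close> and \<open>P_tensor\<close>\<close>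

theorem theorem2p4:
  fixes A :: "('a::{t2_space, second_countable_topology}, 'e::euclidean_space) atlas"
    and J :: "'a endo_field"
    and g g' :: "'a form_field"
    and D D' :: "'a connection"
  assumes "g' = associated_metric J g"
    and "quasi_kaehler_norden A J g"
    and "quasi_kaehler_norden A J g'"
    and "levi_civita A g D"
    and "levi_civita A g' D'"
  shows "(\<forall>x\<in>vector_fields A. \<forall>y\<in>vector_fields A.
            S_connection D' J x y = S_connection D J x y) \<and>
         (\<forall>x\<in>vector_fields A. \<forall>y\<in>vector_fields A. \<forall>z\<in>vector_fields A.
            P_tensor D' J x y z = P_tensor D J x y z)"
proof -
  let ?V = "vector_fields A"
  have M: "smooth_manifold A" and norden: "almost_complex_norden A J g"
    using assms(2) unfolding quasi_kaehler_norden_def almost_complex_norden_def by simp_all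
  have conn: "affine_connection A D" "affine_connection A D'"
    using assms(4,5) unfolding levi_civita_def by simp_all
  have torsion: "D x y - D y x = lie_bracket x y" "D' x y - D' y x = lie_bracket x y"
    if "x \<in> ?V" "y \<in> ?V" for x y
    using assms(4,5) that unfolding levi_civita_def by simp_all
  have D': "D' x y = D x y + T_tensor D J x y" if "x \<in> ?V" "y \<in> ?V" for x y
    using levi_civita_difference[OF assms(2,4) _ that] assms(5) unfolding assms(1) by blast
  \<comment> \<open>The roles are exchanged: \<open>D\<close> is also the Levi-Civita connection of
    the metric associated with \<open>g'\<close>, so the comparison applies to
    \<open>g'\<close>.\<close>
  have D: "D x y = D' x y + T_tensor D' J x y" if "x \<in> ?V" "y \<in> ?V" for x y
    using levi_civita_difference[OF assms(3,5) _ that] levi_civita_associated_twice[OF norden assms(4)]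
    unfolding assms(1) by blast
  have "S_connection D' J x y = S_connection D J x y" if "x \<in> ?V" "y \<in> ?V" for x y
  proof -
    \<comment> \<open>Evaluated at a point and a function, both sides become the average of
      \<open>D\<close> and \<open>D'\<close> by linear arithmetic over the reals.\<close>
    have "S_connection D' J x y p f = S_connection D J x y p f" for p f
      using fun_cong[OF fun_cong[OF D[OF that], of p], of f] fun_cong[OF fun_cong[OF D'[OF that], of p], of f]
      by (simp add: S_connection_def scale_vfield_def scale_tvec_def)
    then show ?thesis by blast
  qed
  moreover have "P_tensor D' J x y z = P_tensor D J x y z"
    if "x \<in> ?V" "y \<in> ?V" "z \<in> ?V" for x y z
  proof -
    have R': "curvature D' x y z = curvature D x y z + Q_tensor D J x y z"
      by (rule curvature_difference[OF M conn torsion(1) D' that])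
    have R: "curvature D x y z = curvature D' x y z + Q_tensor D' J x y z"
      by (rule curvature_difference[OF M conn(2,1) torsion(2) D that])
    have "P_tensor D' J x y z p f = P_tensor D J x y z p f" for p f
      using fun_cong[OF fun_cong[OF R, of p], of f] fun_cong[OF fun_cong[OF R', of p], of f]
      by (simp add: P_tensor_def scale_vfield_def scale_tvec_def)
    then show ?thesis by blast
  qed
  ultimately show ?thesis by blast
qed

end
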